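(* Consider a ring network with $J$ nodes and $J$ classes of connections, class $j\in\{1,\dots,J\}$ using the two nodes $j$ and $j+1$ (indices modulo $J$). If the functions $\beta_j$, $1\le j\le J$, are Lipschitz, continuously differentiable and non-decreasing, then there exists a unique solution $u\in\mathbb{R}_+^J$ of the fixed point equation $$u_j=\phi_{j-1}(u_{j-1},u_j)+\phi_j(u_j,u_{j+1}),\qquad 1\le j\le J.$$
   Context: $\mathbb{R}_+=[0,\infty)$; all indices are understood modulo $J$. The allocation coefficient is $1$ if a class uses a node and $0$ otherwise. For each class $j$, $p_j$ is the proportion of class $j$ connections ($\sum_j p_j=1$), $a_j$ is a non-negative number (linear increase rate), $r_j\in(0,1)$ is the multiplicative decrease factor, and $\beta_j:\mathbb{R}_+^2\to\mathbb{R}_+$ is the loss rate function, evaluated at the utilizations of the two nodes used by class $j$. The function $\phi_j$ is $$\phi_j(s_1,s_2)=p_j\sqrt{\frac{2}{\pi}}\left(\prod_{n=1}^{\infty}\frac{1-r_j^{2n}}{1-r_j^{2n-1}}\right)\sqrt{\frac{a_j}{\beta_j(s_1,s_2)}}.$$ "Non-decreasing" means non-decreasing with respect to the coordinatewise partial order.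
   Formalization: It is additionally assumed that the loss rate β_j is not identically zero for any class j with p_j > 0 and a_j > 0 (otherwise φ_j is nowhere defined); where β_j vanishes, φ_j is read with a/0 = ∞ for a > 0, 0/0 = 0 and 0·∞ = 0. *)

theory Defs
  imports "HOL-Analysis.Analysis"
begin

text \<open>Square root on \<open>[0, \<infinity>]\<close>.\<close>

definition esqrt :: "ennreal \<Rightarrow> ennreal" where
  "esqrt x = (if x = \<infinity> then \<infinity> else ennreal (sqrt (enn2real x)))"

text \<open>
  A loss rate may vanish, so the throughput takes values in \<open>[0, \<infinity>]\<close>: the division is that of
  \<^typ>\<open>ennreal\<close>, where \<open>a / 0 = \<infinity>\<close> for \<open>a > 0\<close> and \<open>0 / 0 = 0\<close>, and \<open>0 * \<infinity> = 0\<close>.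
  (Real division, with \<open>a / 0 = 0\<close>, would create spurious fixed points at which a loss rate
  is zero.) The infinite product is shifted by one, its factor \<open>n\<close> being the usual factor \<open>n + 1\<close>.
\<close>

definition tcp_phi ::
  "real \<Rightarrow> real \<Rightarrow> real \<Rightarrow> (real \<times> real \<Rightarrow> real) \<Rightarrow> real \<Rightarrow> real \<Rightarrow> ennreal" where
  "tcp_phi p a r \<beta> s1 s2 =
     ennreal (p * sqrt (2 / pi) * (\<Prod>n. (1 - r ^ (2 * n + 2)) / (1 - r ^ (2 * n + 1))))
       * esqrt (ennreal a / ennreal (\<beta> (s1, s2)))"

lemma esqrt_divide:
  assumes "0 \<le> a" "0 < b"
  shows "esqrt (ennreal a / ennreal b) = ennreal (sqrt (a / b))"
  using assms by (simp add: esqrt_def divide_ennreal)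

lemma esqrt_divide_zero:
  assumes "0 < a"
  shows "esqrt (ennreal a / ennreal 0) = \<infinity>"
  using assms by (simp add: esqrt_def ennreal_divide_eq_top_iff)

text \<open>
  Continuous differentiability relative to \<open>S\<close>; at boundary points of the quadrant the
  derivative is one-sided.
\<close>

definition C1_on :: "'a::real_normed_vector set \<Rightarrow> ('a \<Rightarrow> 'b::real_normed_vector) \<Rightarrow> bool" where
  "C1_on S f \<longleftrightarrow>
     (\<exists>f' :: 'a \<Rightarrow> 'a \<Rightarrow>\<^sub>L 'b.
        (\<forall>x\<in>S. (f has_derivative blinfun_apply (f' x)) (at x within S)) \<and> continuous_on S f')"

text \<open>Cyclic neighbours in \<open>{1..J}\<close>.\<close>

definition ring_next :: "nat \<Rightarrow> nat \<Rightarrow> nat" where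
  "ring_next J j = (if j = J then 1 else j + 1)"

definition ring_prev :: "nat \<Rightarrow> nat \<Rightarrow> nat" where
  "ring_prev J j = (if j = 1 then J else j - 1)"

definition ring_fixed_point ::
  "nat \<Rightarrow> (nat \<Rightarrow> real \<Rightarrow> real \<Rightarrow> ennreal) \<Rightarrow> (nat \<Rightarrow> real) \<Rightarrow> bool" where
  "ring_fixed_point J \<phi> u \<longleftrightarrow>
     (\<forall>j\<in>{1..J}. ennreal (u j) =
        \<phi> (ring_prev J j) (u (ring_prev J j)) (u j) + \<phi> j (u j) (u (ring_next J j)))"

end

theory Submission
  imports Defs
begin

text \<open>
  Work with the class throughputs \<open>x\<^sub>j = \<phi>\<^sub>j(u\<^sub>j, u\<^sub>j\<^sub>+\<^sub>1)\<close>, which satisfy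
  \<open>x\<^sub>j = \<phi>\<^sub>j(x\<^sub>j\<^sub>-\<^sub>1 + x\<^sub>j, x\<^sub>j + x\<^sub>j\<^sub>+\<^sub>1)\<close>. Given two solutions \<open>x\<close> and \<open>y\<close>, choose \<open>j\<close> with
  \<open>\<bar>x\<^sub>j - y\<^sub>j\<bar>\<close> maximal, say \<open>x\<^sub>j \<ge> y\<^sub>j\<close>: both arguments of \<open>\<phi>\<^sub>j\<close> are then at least as large for
  \<open>x\<close> as for \<open>y\<close>, and \<open>x\<^sub>j \<le> y\<^sub>j\<close> because \<open>\<phi>\<^sub>j\<close> is non-increasing. Hence \<open>x = y\<close>.

  For existence, solve the \<open>j\<close>-th equation for \<open>x\<^sub>j\<close> with its neighbours fixed (intermediate value
  theorem). This defines an antitone map \<open>T\<close>, whose square has a least fixed point \<open>l\<close>. The same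
  maximum principle, applied to \<open>l\<close> and \<open>T l\<close>, gives \<open>T l = l\<close>.
\<close>

section \<open>Comparison of flows for a single class\<close>

definition antitone_quadrant :: "(real \<Rightarrow> real \<Rightarrow> ennreal) \<Rightarrow> bool" where
  "antitone_quadrant f \<longleftrightarrow>
     (\<forall>s s' t t'. 0 \<le> s \<longrightarrow> s \<le> s' \<longrightarrow> 0 \<le> t \<longrightarrow> t \<le> t' \<longrightarrow> f s' t' \<le> f s t)"

text \<open>Here \<open>v\<close> and \<open>w\<close> are the throughputs of the neighbouring
  classes, so \<open>v + x\<close> and \<open>x + w\<close> are the utilizations of the two nodes.
  The bound \<open>0 \<le> x\<close> matters because \<open>ennreal\<close> truncates negative reals
  to 0.\<close>

definition local_flow :: "(real \<Rightarrow> real \<Rightarrow> ennreal) \<Rightarrow> real \<Rightarrow> real \<Rightarrow> real \<Rightarrow> bool" where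
  "local_flow f v w x \<longleftrightarrow> 0 \<le> x \<and> ennreal x = f (v + x) (x + w)"

lemma local_flow_le:
  assumes "antitone_quadrant f" "local_flow f v w x" "local_flow f v' w' y"
    and "0 \<le> v'" "0 \<le> w'" "v' + y \<le> v + x" "y + w' \<le> x + w"
  shows "x \<le> y"
proof -
  have "f (v + x) (x + w) \<le> f (v' + y) (y + w')"
    using assms by (auto simp: antitone_quadrant_def local_flow_def)
  then show ?thesis
    using assms(2,3) by (simp add: local_flow_def flip: ennreal_le_iff)
qed

text \<open>If \<open>y < x\<close>, both utilizations for \<open>x\<close> would dominate those for
  \<open>y\<close>, and \<open>local_flow_le\<close> would give \<open>x \<le> y\<close>.\<close>

lemma local_flow_antimono:
  assumes "antitone_quadrant f" "local_flow f v w x" "local_flow f v' w' y"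
    and "0 \<le> v'" "0 \<le> w'" "v' \<le> v" "w' \<le> w"
  shows "x \<le> y"
proof (rule ccontr)
  assume "\<not> x \<le> y"
  with local_flow_le[OF assms(1-5)] assms(6,7) show False by linarith
qed

lemma local_flow_max_principle:
  assumes "antitone_quadrant f" "local_flow f v w x" "local_flow f v' w' y"
    and "0 \<le> v" "0 \<le> w" "0 \<le> v'" "0 \<le> w'"
    and "\<bar>v - v'\<bar> \<le> \<bar>x - y\<bar>" "\<bar>w - w'\<bar> \<le> \<bar>x - y\<bar>"
  shows "x = y"
proof (cases x y rule: linorder_cases)
  case less
  with local_flow_le[OF assms(1,3,2,4,5)] assms(8,9) show ?thesis by linarith
next
  case greater
  with local_flow_le[OF assms(1-3,6,7)] assms(8,9) show ?thesis by linarith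
qed

text \<open>Equality at an index of maximal distance makes that maximum 0.\<close>

lemma eq_on_if_eq_at_max_dist:
  fixes x y :: "'a \<Rightarrow> real"
  assumes "finite I"
    and "\<And>j. j \<in> I \<Longrightarrow> (\<And>i. i \<in> I \<Longrightarrow> \<bar>x i - y i\<bar> \<le> \<bar>x j - y j\<bar>) \<Longrightarrow> x j = y j"
    and "i \<in> I"
  shows "x i = y i"
proof -
  let ?D = "(\<lambda>i. \<bar>x i - y i\<bar>) ` I"
  have "Max ?D \<in> ?D"
    using assms(1,3) by (intro Max_in) auto
  then obtain j where j: "j \<in> I" "\<bar>x j - y j\<bar> = Max ?D" by auto
  then have le: "\<bar>x k - y k\<bar> \<le> \<bar>x j - y j\<bar>" if "k \<in> I" for k
    using that assms(1) by auto
  from assms(2)[OF j(1) le] le[OF assms(3)] show ?thesis by simp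
qed

section \<open>Systems of flows with given neighbour maps\<close>

text \<open>The neighbours of \<open>j\<close> are \<open>q j\<close> (before) and \<open>n j\<close> (after).\<close>

lemma cyclic_flow_exists:
  fixes f :: "'a \<Rightarrow> real \<Rightarrow> real \<Rightarrow> ennreal"
  assumes fin: "finite I" and n: "n \<in> I \<rightarrow> I" and q: "q \<in> I \<rightarrow> I"
    and anti: "\<And>j. j \<in> I \<Longrightarrow> antitone_quadrant (f j)"
    and ex: "\<And>j v w. j \<in> I \<Longrightarrow> 0 \<le> v \<Longrightarrow> 0 \<le> w \<Longrightarrow> \<exists>x. local_flow (f j) v w x"
  shows "\<exists>x. \<forall>j\<in>I. local_flow (f j) (x (q j)) (x (n j)) (x j)"
proof -
  obtain F where F: "local_flow (f j) v w (F j v w)" if "j \<in> I" "0 \<le> v" "0 \<le> w" for j v w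
    using ex by metis
  define T where "T x j = F j (x (q j)) (x (n j))" for x :: "'a \<Rightarrow> real" and j
  define pos where "pos x \<longleftrightarrow> (\<forall>j\<in>I. 0 \<le> x j)" for x :: "'a \<Rightarrow> real"
  have nq: "n j \<in> I" "q j \<in> I" if "j \<in> I" for j
    using n q that by auto
  have T: "local_flow (f j) (x (q j)) (x (n j)) (T x j)" if "pos x" "j \<in> I" for x j
    using that nq F by (auto simp: T_def pos_def)
  have posT: "pos (T x)" if "pos x" for x
    using T[OF that] by (auto simp: pos_def local_flow_def)
  have T_anti: "\<forall>j\<in>I. T y j \<le> T x j" if "pos x" "\<forall>j\<in>I. x j \<le> y j" for x y
  proof
    fix j assume j: "j \<in> I"
    have "pos y" using that by (force simp: pos_def)
    show "T y j \<le> T x j"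
      using that j nq[OF j]
      by (intro local_flow_antimono[OF anti[OF j] T[OF \<open>pos y\<close> j] T[OF \<open>pos x\<close> j]])
         (auto simp: pos_def)
  qed
  have TT_mono: "\<forall>j\<in>I. T (T x) j \<le> T (T y) j" if "pos x" "\<forall>j\<in>I. x j \<le> y j" for x y
  proof -
    have "pos y" using that by (force simp: pos_def)
    then show ?thesis using T_anti[OF posT T_anti[OF that]] by blast
  qed
  \<comment> \<open>Knaster-Tarski for the monotone square of \<open>T\<close>: \<open>l\<close> is
    the infimum of its nonnegative pre-fixed points. In the reals this requires \<open>X\<close> to
    be nonempty and bounded below, here by 0.\<close>
  define X where "X = {x. pos x \<and> (\<forall>j\<in>I. T (T x) j \<le> x j)}"
  define l where "l j = (INF x\<in>X. x j)" for j
  have pos0: "pos (\<lambda>_. 0)" by (simp add: pos_def)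
  \<comment> \<open>From \<open>0 \<le> T (T 0)\<close>, antitonicity gives
    \<open>T (T (T 0)) \<le> T 0\<close>.\<close>
  have "T (\<lambda>_. 0) \<in> X"
    using T_anti[OF pos0, of "T (T (\<lambda>_. 0))"] posT[OF pos0] posT[OF posT[OF pos0]]
    by (auto simp: X_def pos_def)
  then have X_ne: "X \<noteq> {}" by blast
  have l_le: "\<forall>j\<in>I. l j \<le> x j" if "x \<in> X" for x
    using that by (auto simp: l_def X_def pos_def intro!: cINF_lower bdd_belowI2[where m = 0])
  have pos_l: "pos l"
    using X_ne by (auto simp: pos_def l_def X_def intro!: cINF_greatest)
  have TTl_le: "\<forall>j\<in>I. T (T l) j \<le> l j"
  proof
    fix j assume j: "j \<in> I"
    show "T (T l) j \<le> l j"
      unfolding l_def[of j]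
    proof (rule cINF_greatest[OF X_ne])
      fix x assume "x \<in> X"
      then show "T (T l) j \<le> x j"
        using TT_mono[OF pos_l l_le[OF \<open>x \<in> X\<close>]] j by (force simp: X_def)
    qed
  qed
  have "T (T l) \<in> X"
    using TT_mono[OF posT[OF posT[OF pos_l]] TTl_le] posT[OF posT[OF pos_l]]
    by (simp add: X_def)
  then have TTl: "T (T l) j = l j" if "j \<in> I" for j
    using that l_le TTl_le by (meson antisym)
  \<comment> \<open>On \<open>I\<close>, \<open>T l\<close> solves the local equations with
    neighbours \<open>l\<close>, and \<open>l = T (T l)\<close> solves them with neighbours
    \<open>T l\<close>; the neighbour gaps are thus again distances between \<open>T l\<close> and
    \<open>l\<close>.\<close>
  have Tl: "T l j = l j" if "j \<in> I" for j
  proof (rule eq_on_if_eq_at_max_dist[OF fin _ that])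
    fix j assume j: "j \<in> I" and le: "\<And>i. i \<in> I \<Longrightarrow> \<bar>T l i - l i\<bar> \<le> \<bar>T l j - l j\<bar>"
    have "local_flow (f j) (T l (q j)) (T l (n j)) (l j)"
      using T[OF posT[OF pos_l] j] TTl[OF j] by simp
    then show "T l j = l j"
      using pos_l posT[OF pos_l] nq[OF j] le[of "q j"] le[of "n j"]
      by (intro local_flow_max_principle[OF anti[OF j] T[OF pos_l j]])
         (auto simp: pos_def abs_minus_commute)
  qed
  show ?thesis
    using T[OF pos_l] Tl by (intro exI[of _ l]) simp
qed

lemma cyclic_flow_unique:
  fixes f :: "'a \<Rightarrow> real \<Rightarrow> real \<Rightarrow> ennreal"
  assumes fin: "finite I" and n: "n \<in> I \<rightarrow> I" and q: "q \<in> I \<rightarrow> I"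
    and anti: "\<And>j. j \<in> I \<Longrightarrow> antitone_quadrant (f j)"
    and x: "\<And>j. j \<in> I \<Longrightarrow> local_flow (f j) (x (q j)) (x (n j)) (x j)"
    and y: "\<And>j. j \<in> I \<Longrightarrow> local_flow (f j) (y (q j)) (y (n j)) (y j)"
    and "j \<in> I"
  shows "x j = y j"
proof (rule eq_on_if_eq_at_max_dist[OF fin _ \<open>j \<in> I\<close>])
  fix j assume j: "j \<in> I" and le: "\<And>i. i \<in> I \<Longrightarrow> \<bar>x i - y i\<bar> \<le> \<bar>x j - y j\<bar>"
  have nq: "n j \<in> I" "q j \<in> I" using n q j by auto
  show "x j = y j"
    using nq le x[OF nq(1)] x[OF nq(2)] y[OF nq(1)] y[OF nq(2)]
    by (intro local_flow_max_principle[OF anti[OF j] x[OF j] y[OF j]])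
       (auto simp: local_flow_def)
qed

section \<open>Throughputs and utilizations on the ring\<close>

lemma ring_next_mem: "ring_next J \<in> {1..J} \<rightarrow> {1..J}"
  by (auto simp: ring_next_def)

lemma ring_prev_mem: "ring_prev J \<in> {1..J} \<rightarrow> {1..J}"
  by (auto simp: ring_prev_def)

text \<open>This includes \<open>J = 1\<close>, where both neighbour maps fix 1.\<close>

lemma ring_next_prev: "j \<in> {1..J} \<Longrightarrow> ring_next J (ring_prev J j) = j"
  by (auto simp: ring_next_def ring_prev_def)

lemma ring_prev_next: "j \<in> {1..J} \<Longrightarrow> ring_prev J (ring_next J j) = j"
  by (auto simp: ring_next_def ring_prev_def)

lemma ring_fixed_point_flow:
  assumes u: "u \<in> {1..J} \<rightarrow> {0..}" and fp: "ring_fixed_point J f u"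
  defines "x \<equiv> \<lambda>j. enn2real (f j (u j) (u (ring_next J j)))"
  shows "\<And>j. j \<in> {1..J} \<Longrightarrow> u j = x (ring_prev J j) + x j"
    and "\<And>j. j \<in> {1..J} \<Longrightarrow> local_flow (f j) (x (ring_prev J j)) (x (ring_next J j)) (x j)"
proof -
  have eq: "ennreal (u j) = f (ring_prev J j) (u (ring_prev J j)) (u j)
      + f j (u j) (u (ring_next J j))" if "j \<in> {1..J}" for j
    using fp that unfolding ring_fixed_point_def by blast
  \<comment> \<open>\<open>enn2real\<close> would send an infinite throughput to 0; it loses nothing
    here, since each summand of the finite \<open>u j\<close> is finite.\<close>
  have fin: "f j (u j) (u (ring_next J j)) < top" if "j \<in> {1..J}" for j
    using eq[OF that] by (metis ennreal_add_eq_top ennreal_neq_top top.not_eq_extremum)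
  then have x: "ennreal (x j) = f j (u j) (u (ring_next J j))" if "j \<in> {1..J}" for j
    using that by (simp add: x_def)
  have x0: "0 \<le> x j" for j by (simp add: x_def)
  show sum: "u j = x (ring_prev J j) + x j" if j: "j \<in> {1..J}" for j
  proof -
    have "ring_prev J j \<in> {1..J}" using ring_prev_mem j by blast
    then have "ennreal (u j) = ennreal (x (ring_prev J j)) + ennreal (x j)"
      using eq[OF j] x j ring_next_prev[OF j] by simp
    then show ?thesis
      using u j x0 by (simp add: PiE_iff Pi_iff flip: ennreal_plus)
  qed
  show "local_flow (f j) (x (ring_prev J j)) (x (ring_next J j)) (x j)" if j: "j \<in> {1..J}" for j
  proof -
    have "ring_next J j \<in> {1..J}" using ring_next_mem j by blast
    then show ?thesis
      using sum[OF j] sum[of "ring_next J j"] x[OF j] x0 ring_prev_next[OF j]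
      by (simp add: local_flow_def)
  qed
qed

text \<open>The extensional function space fixes \<open>u\<close> outside the index set, where the
  equations say nothing.\<close>

theorem ring_fixed_point_ex1:
  assumes anti: "\<And>j. j \<in> {1..J} \<Longrightarrow> antitone_quadrant (f j)"
    and ex: "\<And>j v w. j \<in> {1..J} \<Longrightarrow> 0 \<le> v \<Longrightarrow> 0 \<le> w \<Longrightarrow> \<exists>x. local_flow (f j) v w x"
  shows "\<exists>!u. u \<in> {1..J} \<rightarrow>\<^sub>E {0..} \<and> ring_fixed_point J f u"
proof (rule ex_ex1I)
  obtain x where x: "\<And>j. j \<in> {1..J} \<Longrightarrow>
      local_flow (f j) (x (ring_prev J j)) (x (ring_next J j)) (x j)"
    using cyclic_flow_exists[of "{1..J}" "ring_next J" "ring_prev J" f]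
      ring_next_mem ring_prev_mem anti ex by blast
  define u where "u = (\<lambda>j\<in>{1..J}. x (ring_prev J j) + x j)"
  have x0: "0 \<le> x j" if "j \<in> {1..J}" for j
    using x[OF that] by (simp add: local_flow_def)
  have prev: "ring_prev J j \<in> {1..J}" and nxt: "ring_next J j \<in> {1..J}" if "j \<in> {1..J}" for j
    using that ring_prev_mem ring_next_mem by blast+
  have u0: "u \<in> {1..J} \<rightarrow>\<^sub>E {0..}"
    using x0 prev by (auto simp: u_def simp del: atLeastAtMost_iff)
  have f: "f j (u j) (u (ring_next J j)) = ennreal (x j)" if "j \<in> {1..J}" for j
    using x[OF that] nxt[OF that] that ring_prev_next[OF that]
    by (simp add: u_def local_flow_def)
  have "ring_fixed_point J f u"
    unfolding ring_fixed_point_def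
  proof
    fix j assume j: "j \<in> {1..J}"
    have "ennreal (u j) = ennreal (x (ring_prev J j)) + ennreal (x j)"
      using j x0[OF j] x0[OF prev[OF j]] by (simp add: u_def)
    then show "ennreal (u j) = f (ring_prev J j) (u (ring_prev J j)) (u j)
        + f j (u j) (u (ring_next J j))"
      using f[OF j] f[OF prev[OF j]] ring_next_prev[OF j] by simp
  qed
  with u0 show "\<exists>u. u \<in> {1..J} \<rightarrow>\<^sub>E {0..} \<and> ring_fixed_point J f u" by blast
next
  fix u v
  assume u: "u \<in> {1..J} \<rightarrow>\<^sub>E {0..} \<and> ring_fixed_point J f u"
    and v: "v \<in> {1..J} \<rightarrow>\<^sub>E {0..} \<and> ring_fixed_point J f v"
  then have u': "u \<in> {1..J} \<rightarrow> {0..}" "ring_fixed_point J f u"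
    and v': "v \<in> {1..J} \<rightarrow> {0..}" "ring_fixed_point J f v"
    by auto
  note U = ring_fixed_point_flow[OF u'] and V = ring_fixed_point_flow[OF v']
  have eq: "enn2real (f j (u j) (u (ring_next J j))) = enn2real (f j (v j) (v (ring_next J j)))"
    if "j \<in> {1..J}" for j
    by (rule cyclic_flow_unique[OF finite_atLeastAtMost ring_next_mem ring_prev_mem anti
          U(2) V(2) that])
  show "u = v"
  proof (rule PiE_ext)
    fix j assume j: "j \<in> {1..J}"
    then have "ring_prev J j \<in> {1..J}" using ring_prev_mem by blast
    then show "u j = v j"
      using U(1)[OF j] V(1)[OF j] eq[OF j] eq[of "ring_prev J j"] by simp
  qed (use u v in auto)
qed

section \<open>The TCP throughput function\<close>

lemma esqrt_mono: "x \<le> y \<Longrightarrow> esqrt x \<le> esqrt y"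
  by (auto simp: esqrt_def top_unique less_top intro!: ennreal_leI enn2real_mono)

lemma inverse_antimono_ennreal:
  fixes x y :: ennreal
  shows "x \<le> y \<Longrightarrow> inverse y \<le> inverse x"
  including ennreal.lifting by transfer (rule ereal_inverse_antimono)

text \<open>Inversion is antitone on all of \<open>ennreal\<close>, with
  \<open>inverse 0 = \<infinity>\<close>, so vanishing loss rates need no separate case.\<close>

lemma antitone_quadrant_tcp_phi:
  assumes "mono_on ({0..} \<times> {0..}) \<beta>"
  shows "antitone_quadrant (tcp_phi p a r \<beta>)"
  unfolding antitone_quadrant_def
proof (intro allI impI)
  fix s s' t t' :: real
  assume "0 \<le> s" "s \<le> s'" "0 \<le> t" "t \<le> t'"
  then have "\<beta> (s, t) \<le> \<beta> (s', t')"
    by (intro mono_onD[OF assms]) auto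
  then show "tcp_phi p a r \<beta> s' t' \<le> tcp_phi p a r \<beta> s t"
    unfolding tcp_phi_def divide_ennreal_def
    by (intro mult_left_mono esqrt_mono inverse_antimono_ennreal ennreal_leI) auto
qed

text \<open>Clearing the root turns the equation into \<open>g x = k\<close>, where \<open>g\<close>
  is continuous, \<open>g 0 = 0\<close>, and \<open>g\<close> reaches \<open>k\<close> because the
  monotone loss rate stays positive beyond a point where it is nonzero.\<close>

lemma tcp_phi_local_flow_exists:
  assumes "0 \<le> p" "0 \<le> a" and nonneg: "\<beta> \<in> {0..} \<times> {0..} \<rightarrow> {0..}"
    and cont: "continuous_on ({0..} \<times> {0..}) \<beta>"
    and mono: "mono_on ({0..} \<times> {0..}) \<beta>"
    and nonzero: "0 < p \<Longrightarrow> 0 < a \<Longrightarrow> \<exists>s\<in>{0..} \<times> {0..}. \<beta> s \<noteq> 0"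
    and "0 \<le> v" "0 \<le> w"
  shows "\<exists>x. local_flow (tcp_phi p a r \<beta>) v w x"
proof -
  define c where
    "c = p * sqrt (2 / pi) * (\<Prod>n. (1 - r ^ (2 * n + 2)) / (1 - r ^ (2 * n + 1)))"
  have phi: "tcp_phi p a r \<beta> s t = ennreal c * esqrt (ennreal a / ennreal (\<beta> (s, t)))" for s t
    by (simp add: tcp_phi_def c_def)
  show ?thesis
  proof (cases "0 < c \<and> 0 < a")
    \<comment> \<open>If \<open>c \<le> 0\<close>, then \<open>ennreal c = 0\<close>; if
      \<open>a = 0\<close>, the quotient is 0 even over 0. Either way \<open>x = 0\<close>
      works.\<close>
    case False
    then have "tcp_phi p a r \<beta> v w = 0"
      using \<open>0 \<le> a\<close> by (auto simp: phi esqrt_def ennreal_neg not_less)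
    then show ?thesis
      by (intro exI[of _ 0]) (simp add: local_flow_def)
  next
    case True
    then have "p \<noteq> 0" by (auto simp: c_def)
    with \<open>0 \<le> p\<close> True nonzero obtain s t where st: "0 \<le> s" "0 \<le> t" "\<beta> (s, t) \<noteq> 0"
      by auto
    define b where "b = sqrt (\<beta> (s, t))"
    have "0 \<le> \<beta> (s, t)" using nonneg st by auto
    with st have b: "0 < b" by (simp add: b_def)
    define g where "g x = x * sqrt (\<beta> (v + x, x + w))" for x
    define k where "k = c * sqrt a"
    have k: "0 < k" using True by (simp add: k_def)
    \<comment> \<open>Beyond \<open>s\<close> and \<open>t\<close> the root of the loss rate is at
      least \<open>b\<close>; together with \<open>k / b \<le> m\<close> this gives
      \<open>k \<le> g m\<close>.\<close>
    define m where "m = max (max s t) (k / b)"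
    have m: "s \<le> m" "t \<le> m" "k / b \<le> m" "0 \<le> m" using st by (auto simp: m_def)
    have "\<beta> (s, t) \<le> \<beta> (v + m, m + w)"
      using m st assms(7,8) by (intro mono_onD[OF mono]) auto
    then have "b \<le> sqrt (\<beta> (v + m, m + w))" by (simp add: b_def)
    then have "(k / b) * b \<le> g m"
      unfolding g_def using m b k by (intro mult_mono) auto
    then have "k \<le> g m" using b by simp
    moreover have "continuous_on {0..m} g"
      unfolding g_def using assms(7,8)
      by (intro continuous_intros continuous_on_compose2[OF cont]) auto
    moreover have "g 0 \<le> k" using k by (simp add: g_def)
    ultimately obtain x where x: "0 \<le> x" "g x = k"
      using IVT'[of g 0 k m] m by auto
    let ?B = "\<beta> (v + x, x + w)"
    have "0 \<le> ?B" using nonneg x assms(7,8) by auto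
    \<comment> \<open>A zero loss rate would give \<open>g x = 0 < k\<close>.\<close>
    moreover have "?B \<noteq> 0" using x k by (auto simp: g_def)
    ultimately have B: "0 < ?B" by simp
    then have "x = c * sqrt (a / ?B)"
      using x by (simp add: g_def k_def real_sqrt_divide field_simps)
    then have "ennreal x = ennreal c * ennreal (sqrt (a / ?B))"
      using True B by (subst ennreal_mult[symmetric]) auto
    then have "ennreal x = tcp_phi p a r \<beta> (v + x) (x + w)"
      using True B by (simp add: phi esqrt_divide)
    then show ?thesis
      using x by (auto simp: local_flow_def)
  qed
qed

text \<open>The last hypothesis excludes an identically zero loss rate for a class with
  \<open>p j\<close> and \<open>a j\<close> positive: its throughput would be infinite everywhere,
  and no real \<open>u\<close> could solve the equations.\<close>

theorem proposition6:
  fixes J :: nat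
    and p a r :: "nat \<Rightarrow> real"
    and \<beta> :: "nat \<Rightarrow> real \<times> real \<Rightarrow> real"
  assumes "1 \<le> J"
    and "\<And>j. j \<in> {1..J} \<Longrightarrow> 0 \<le> p j"
    and "(\<Sum>j=1..J. p j) = 1"
    and "\<And>j. j \<in> {1..J} \<Longrightarrow> 0 \<le> a j"
    and "\<And>j. j \<in> {1..J} \<Longrightarrow> 0 < r j \<and> r j < 1"
    and "\<And>j. j \<in> {1..J} \<Longrightarrow> \<beta> j \<in> {0..} \<times> {0..} \<rightarrow> {0..}"
    and "\<And>j. j \<in> {1..J} \<Longrightarrow> \<exists>L. L-lipschitz_on ({0..} \<times> {0..}) (\<beta> j)"
    and "\<And>j. j \<in> {1..J} \<Longrightarrow> C1_on ({0..} \<times> {0..}) (\<beta> j)"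
    and "\<And>j. j \<in> {1..J} \<Longrightarrow> mono_on ({0..} \<times> {0..}) (\<beta> j)"
    and "\<And>j. j \<in> {1..J} \<Longrightarrow> 0 < p j \<Longrightarrow> 0 < a j \<Longrightarrow> \<exists>s\<in>{0..} \<times> {0..}. \<beta> j s \<noteq> 0"
  shows "\<exists>!u. u \<in> {1..J} \<rightarrow>\<^sub>E {0..} \<and>
           ring_fixed_point J (\<lambda>j. tcp_phi (p j) (a j) (r j) (\<beta> j)) u"
proof (rule ring_fixed_point_ex1)
  fix j assume j: "j \<in> {1..J}"
  show "antitone_quadrant (tcp_phi (p j) (a j) (r j) (\<beta> j))"
    by (rule antitone_quadrant_tcp_phi[OF assms(9)[OF j]])
  fix v w :: real
  assume "0 \<le> v" "0 \<le> w"
  moreover have "continuous_on ({0..} \<times> {0..}) (\<beta> j)"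
    using assms(7)[OF j] lipschitz_on_continuous_on by blast
  ultimately show "\<exists>x. local_flow (tcp_phi (p j) (a j) (r j) (\<beta> j)) v w x"
    using tcp_phi_local_flow_exists assms(2,4,6,9,10) j by presburger
qed

end
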